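(* Let $n\geq 1$, let $T\subseteq\mathbb{R}^n$ and let $\beta$ be the corresponding betweenness relation on $T$. Assume that $T$ extends linearly in $2D$. Then the monadic $\Pi^1_1$-theory of $(T,\beta)$ is $\Sigma^0_1$-hard.
   Context: Let $d$ be the Euclidean metric on $\mathbb{R}^n$. The betweenness relation $\beta$ on $\mathbb{R}^n$ is given by $\beta(s,t,u)$ iff $d(s,u)=d(s,t)+d(t,u)$; for $T\subseteq\mathbb{R}^n$, $(T,\beta)$ denotes the structure with domain $T$ and $\beta$ restricted to $T$. Points $s,t,u$ are collinear iff $\beta(s,t,u)\vee\beta(s,u,t)\vee\beta(t,s,u)$. For $U\subseteq\mathbb{R}^n$, a line in $U$ is a set $L\subseteq U$ such that: (i) $L$ contains two distinct points; (ii) any three points of $L$ are collinear; (iii) whenever $s,t\in L$, $s\neq t$, and $u\in U$ satisfies $\beta(s,u,t)$ or $\beta(s,t,u)$, then $u\in L$. An $m$-dimensional flat of $\mathbb{R}^n$ ($0\le m\le n$) is a set $\{h+r_1v_1+\dots+r_mv_m: r_1,\dots,r_m\in\mathbb{R}\}$ with $h\in\mathbb{R}^n$ and $v_1,\dots,v_m$ linearly independent nonzero vectors. A set $U\subseteq\mathbb{R}^n$ is a linearly regular $m$-dimensional flat if: (1) $U$ is contained in some $m$-dimensional flat; (2) $U$ is contained in no $(m-1)$-dimensional flat; (3) (linear completeness) for every line $L$ in $U$, with $L'$ the Euclidean line of $\mathbb{R}^n$ containing $L$, for every $r\in L'$ and every $\epsilon>0$ there is $s\in L$ with $d(s,r)<\epsilon$;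 (4) (linear closedness) if $L_1\neq L_2$ are lines in $U$ whose containing Euclidean lines of $\mathbb{R}^n$ meet, then $L_1\cap L_2\neq\emptyset$. A set $T\subseteq\mathbb{R}^n$ extends linearly in $mD$ if there exist a linearly regular $m$-dimensional flat $S$, a real $\epsilon>0$ and a point $x\in S\cap T$ such that $\{u\in S: d(x,u)<\epsilon\}\subseteq T$. The monadic $\Pi^1_1$-theory of $(T,\beta)$ is the set of sentences $\forall X_1\cdots\forall X_k\,\varphi$ ($X_i$ unary relation variables, $\varphi$ first-order of vocabulary $\{\beta,X_1,\dots,X_k\}$) true in $(T,\beta)$ with the $X_i$ ranging over all subsets of $T$. Hardness is with respect to computable many-one reductions. *)

theory Defs
  imports "HOL-Analysis.Analysis" "HOL-Library.Nat_Bijection"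
begin

definition btw :: "'a::metric_space \<Rightarrow> 'a \<Rightarrow> 'a \<Rightarrow> bool" where
  "btw s t u \<longleftrightarrow> dist s u = dist s t + dist t u"

definition collinear3 :: "'a::metric_space \<Rightarrow> 'a \<Rightarrow> 'a \<Rightarrow> bool" where
  "collinear3 s t u \<longleftrightarrow> btw s t u \<or> btw s u t \<or> btw t s u"

definition line_in :: "'a::metric_space set \<Rightarrow> 'a set \<Rightarrow> bool" where
  "line_in U L \<longleftrightarrow>
     L \<subseteq> U \<and>
     (\<exists>s\<in>L. \<exists>t\<in>L. s \<noteq> t) \<and>
     (\<forall>s\<in>L. \<forall>t\<in>L. \<forall>u\<in>L. collinear3 s t u) \<and>
     (\<forall>s\<in>L. \<forall>t\<in>L. \<forall>u\<in>U. s \<noteq> t \<and> (btw s u t \<or> btw s t u) \<longrightarrow> u \<in> L)"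

definition flat :: "nat \<Rightarrow> 'a::euclidean_space set \<Rightarrow> bool" where
  "flat m F \<longleftrightarrow>
     (\<exists>h. \<exists>v :: nat \<Rightarrow> 'a. inj_on v {..<m} \<and> independent (v ` {..<m}) \<and>
        F = {h + (\<Sum>i<m. r i *\<^sub>R v i) | r :: nat \<Rightarrow> real. True})"

text \<open>
  The condition on the next lower dimension is stated through \<open>m = Suc k\<close>, so that it
  is void for \<open>m = 0\<close>, there being no flats of dimension \<open>-1\<close>. The Euclidean line
  containing a line \<open>L\<close> in \<open>U\<close> is the unique one-dimensional flat containing \<open>L\<close>.
\<close>

definition linearly_complete :: "'a::euclidean_space set \<Rightarrow> bool" where
  "linearly_complete U \<longleftrightarrow>
     (\<forall>L L'. line_in U L \<and> flat 1 L' \<and> L \<subseteq> L' \<longrightarrow>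
        (\<forall>r\<in>L'. \<forall>\<epsilon>>0. \<exists>s\<in>L. dist s r < \<epsilon>))"

definition linearly_closed :: "'a::euclidean_space set \<Rightarrow> bool" where
  "linearly_closed U \<longleftrightarrow>
     (\<forall>L1 L2 L1' L2'. line_in U L1 \<and> line_in U L2 \<and> L1 \<noteq> L2 \<and>
        flat 1 L1' \<and> L1 \<subseteq> L1' \<and> flat 1 L2' \<and> L2 \<subseteq> L2' \<and> L1' \<inter> L2' \<noteq> {} \<longrightarrow>
        L1 \<inter> L2 \<noteq> {})"

definition linearly_regular_flat :: "nat \<Rightarrow> 'a::euclidean_space set \<Rightarrow> bool" where
  "linearly_regular_flat m U \<longleftrightarrow>
     (\<exists>F. flat m F \<and> U \<subseteq> F) \<and>
     (\<forall>k. m = Suc k \<longrightarrow> \<not> (\<exists>F. flat k F \<and> U \<subseteq> F)) \<and>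
     linearly_complete U \<and> linearly_closed U"

definition extends_linearly :: "nat \<Rightarrow> 'a::euclidean_space set \<Rightarrow> bool" where
  "extends_linearly m T \<longleftrightarrow>
     (\<exists>S \<epsilon> x. linearly_regular_flat m S \<and> \<epsilon> > 0 \<and> x \<in> S \<inter> T \<and>
        {u \<in> S. dist x u < \<epsilon>} \<subseteq> T)"

text \<open>
  First-order variables and unary relation variables are both named by natural numbers;
  \<open>Mem i x\<close> is the atom \<open>X\<^sub>i(x)\<close>. The remaining connectives and the universal
  quantifier are definable.
\<close>

datatype fm =
    Eq nat nat
  | Btw nat nat nat
  | Mem nat nat
  | Neg fm
  | Conj fm fm
  | Ex nat fm

primrec free_vars :: "fm \<Rightarrow> nat set" where
  "free_vars (Eq x y) = {x, y}"
| "free_vars (Btw x y z) = {x, y, z}"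
| "free_vars (Mem i x) = {x}"
| "free_vars (Neg p) = free_vars p"
| "free_vars (Conj p q) = free_vars p \<union> free_vars q"
| "free_vars (Ex x p) = free_vars p - {x}"

primrec set_vars :: "fm \<Rightarrow> nat set" where
  "set_vars (Eq x y) = {}"
| "set_vars (Btw x y z) = {}"
| "set_vars (Mem i x) = {i}"
| "set_vars (Neg p) = set_vars p"
| "set_vars (Conj p q) = set_vars p \<union> set_vars q"
| "set_vars (Ex x p) = set_vars p"

primrec sat :: "'a::metric_space set \<Rightarrow> (nat \<Rightarrow> 'a set) \<Rightarrow> (nat \<Rightarrow> 'a) \<Rightarrow> fm \<Rightarrow> bool" where
  "sat T X e (Eq x y) \<longleftrightarrow> e x = e y"
| "sat T X e (Btw x y z) \<longleftrightarrow> btw (e x) (e y) (e z)"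
| "sat T X e (Mem i x) \<longleftrightarrow> e x \<in> X i"
| "sat T X e (Neg p) \<longleftrightarrow> \<not> sat T X e p"
| "sat T X e (Conj p q) \<longleftrightarrow> sat T X e p \<and> sat T X e q"
| "sat T X e (Ex x p) \<longleftrightarrow> (\<exists>a\<in>T. sat T X (e(x := a)) p)"

text \<open>
  The pair \<open>(k, p)\<close> stands for the sentence \<open>\<forall>X\<^sub>0 \<dots> X\<^sub>k\<^sub>-\<^sub>1. p\<close>. The matrix has no free
  first-order variables, so the assignment \<open>e\<close> is irrelevant.
\<close>

definition monadic_Pi11_sentence :: "nat \<times> fm \<Rightarrow> bool" where
  "monadic_Pi11_sentence = (\<lambda>(k, p). free_vars p = {} \<and> set_vars p \<subseteq> {..<k})"

definition holds_in :: "'a::metric_space set \<Rightarrow> nat \<times> fm \<Rightarrow> bool" where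
  "holds_in T = (\<lambda>(k, p). \<forall>X. (\<forall>i<k. X i \<subseteq> T) \<longrightarrow> (\<forall>e. sat T X e p))"

definition monadic_Pi11_theory :: "'a::metric_space set \<Rightarrow> (nat \<times> fm) set" where
  "monadic_Pi11_theory T = {\<psi>. monadic_Pi11_sentence \<psi> \<and> holds_in T \<psi>}"

primrec fm_code :: "fm \<Rightarrow> nat" where
  "fm_code (Eq x y) = prod_encode (0, prod_encode (x, y))"
| "fm_code (Btw x y z) = prod_encode (1, prod_encode (x, prod_encode (y, z)))"
| "fm_code (Mem i x) = prod_encode (2, prod_encode (i, x))"
| "fm_code (Neg p) = prod_encode (3, fm_code p)"
| "fm_code (Conj p q) = prod_encode (4, prod_encode (fm_code p, fm_code q))"
| "fm_code (Ex x p) = prod_encode (5, prod_encode (x, fm_code p))"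

definition sentence_code :: "nat \<times> fm \<Rightarrow> nat" where
  "sentence_code = (\<lambda>(k, p). prod_encode (k, fm_code p))"

lemma fm_code_inject: "fm_code p = fm_code q \<longleftrightarrow> p = q"
proof (induction p arbitrary: q)
  case (Eq x y) show ?case by (cases q) auto
next
  case (Btw x y z) show ?case by (cases q) auto
next
  case (Mem i x) show ?case by (cases q) auto
next
  case (Neg p) then show ?case by (cases q) auto
next
  case (Conj p1 p2) then show ?case by (cases q) auto
next
  case (Ex x p) then show ?case by (cases q) auto
qed

lemma inj_sentence_code: "inj sentence_code"
  by (auto simp: inj_def sentence_code_def fm_code_inject)

text \<open>
  Kleene's partial recursive functions. Projections count from \<open>0\<close>; primitive recursion
  and minimisation act on the first argument, and minimisation requires the values at all
  smaller arguments to be defined.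
\<close>

datatype recf =
    Zero
  | Succ
  | Proj nat
  | Comp recf "recf list"
  | Prec recf recf
  | Mu recf

inductive rec_eval :: "recf \<Rightarrow> nat list \<Rightarrow> nat \<Rightarrow> bool" where
  zero: "rec_eval Zero xs 0"
| succ: "rec_eval Succ [x] (Suc x)"
| proj: "i < length xs \<Longrightarrow> rec_eval (Proj i) xs (xs ! i)"
| comp: "list_all2 (\<lambda>g y. rec_eval g xs y) gs ys \<Longrightarrow> rec_eval f ys z \<Longrightarrow>
    rec_eval (Comp f gs) xs z"
| prec_0: "rec_eval f xs y \<Longrightarrow> rec_eval (Prec f g) (0 # xs) y"
| prec_Suc: "rec_eval (Prec f g) (n # xs) y \<Longrightarrow> rec_eval g (n # y # xs) z \<Longrightarrow>
    rec_eval (Prec f g) (Suc n # xs) z"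
| mu: "rec_eval f (n # xs) 0 \<Longrightarrow> (\<And>i. i < n \<Longrightarrow> \<exists>y. rec_eval f (i # xs) (Suc y)) \<Longrightarrow>
    rec_eval (Mu f) xs n"

inductive_cases rec_eval_elims:
  "rec_eval Zero xs y" "rec_eval Succ xs y" "rec_eval (Proj i) xs y"
  "rec_eval (Comp f gs) xs y" "rec_eval (Prec f g) (0 # xs) y"
  "rec_eval (Prec f g) (Suc n # xs) y" "rec_eval (Mu f) xs y"

lemma rec_eval_deterministic:
  "rec_eval f xs y \<Longrightarrow> rec_eval f xs z \<Longrightarrow> y = z"
proof (induction arbitrary: z rule: rec_eval.induct)
  case (zero xs)
  from zero.prems show ?case by (rule rec_eval_elims(1)) simp
next
  case (succ x)
  from succ.prems show ?case by (rule rec_eval_elims(2)) simp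
next
  case (proj i xs)
  from proj.prems show ?case by (rule rec_eval_elims(3)) simp
next
  case (comp xs gs ys f w)
  from comp.prems show ?case
  proof (rule rec_eval_elims(4))
    fix ys'
    assume ys': "list_all2 (\<lambda>g. rec_eval g xs) gs ys'" "rec_eval f ys' z"
    have "ys = ys'"
    proof (rule nth_equalityI)
      show "length ys = length ys'"
        using comp.IH(1) ys'(1) by (rule trans[OF sym, OF list_all2_lengthD list_all2_lengthD])
      show "ys ! i = ys' ! i" if "i < length ys" for i
      proof -
        have "rec_eval (gs ! i) xs (ys' ! i)"
          using list_all2_nthD2[OF ys'(1)] that \<open>length ys = length ys'\<close> by simp
        with list_all2_nthD2[OF comp.IH(1) that]
        show ?thesis by (elim conjE allE impE)
      qed
    qed
    with ys'(2) have "rec_eval f ys z" by simp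
    then show ?thesis by (rule comp.IH(2))
  qed
next
  case (prec_0 f xs y g)
  from prec_0.prems show ?case by (rule rec_eval_elims(5)) (rule prec_0.IH)
next
  case (prec_Suc f g n xs y w)
  from prec_Suc.prems show ?case
  proof (rule rec_eval_elims(6))
    fix y' assume y': "rec_eval (Prec f g) (n # xs) y'" "rec_eval g (n # y' # xs) z"
    from y'(2) have "rec_eval g (n # y # xs) z"
      unfolding prec_Suc.IH(1)[OF y'(1)] .
    then show ?thesis by (rule prec_Suc.IH(2))
  qed
next
  case (mu f n xs)
  from mu.prems show ?case
  proof (rule rec_eval_elims(7))
    assume z: "rec_eval f (z # xs) 0" "\<And>i. i < z \<Longrightarrow> \<exists>y. rec_eval f (i # xs) (Suc y)"
    show ?thesis
    proof (rule linorder_cases[of n z])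
      assume "n < z"
      from z(2)[OF this] obtain y where "rec_eval f (n # xs) (Suc y)" ..
      from mu.IH(1)[OF this] show ?thesis by simp
    next
      assume "z < n"
      from mu.IH(2)[OF this] obtain y
        where "\<forall>w. rec_eval f (z # xs) w \<longrightarrow> Suc y = w" by (elim exE conjE)
      from this[rule_format, OF z(1)] show ?thesis by simp
    qed simp
  qed
qed

definition computable :: "(nat \<Rightarrow> nat) \<Rightarrow> bool" where
  "computable f \<longleftrightarrow> (\<exists>p. \<forall>x. rec_eval p [x] (f x))"

definition decidable2 :: "(nat \<Rightarrow> nat \<Rightarrow> bool) \<Rightarrow> bool" where
  "decidable2 R \<longleftrightarrow> (\<exists>p. \<forall>x y. rec_eval p [x, y] (of_bool (R x y)))"

definition Sigma01 :: "nat set \<Rightarrow> bool" where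
  "Sigma01 A \<longleftrightarrow> (\<exists>R. decidable2 R \<and> A = {x. \<exists>y. R x y})"

definition many_one_reducible :: "nat set \<Rightarrow> nat set \<Rightarrow> bool" where
  "many_one_reducible A B \<longleftrightarrow> (\<exists>f. computable f \<and> (\<forall>x. x \<in> A \<longleftrightarrow> f x \<in> B))"

definition Sigma01_hard :: "nat set \<Rightarrow> bool" where
  "Sigma01_hard B \<longleftrightarrow> (\<forall>A. Sigma01 A \<longrightarrow> many_one_reducible A B)"

end

theory Submission
  imports Defs
begin

text \<open>
  Inside \<open>T\<close> one finds points \<open>P\<^sub>i\<close>, \<open>Q\<^sub>j\<close> and \<open>M\<^sub>i\<^sub>j\<close> such that \<open>M\<^sub>i\<^sub>j\<close> lies on the segment
  \<open>P\<^sub>kQ\<^sub>l\<close> only for \<open>(k, l) = (i, j)\<close>: take \<open>P\<^sub>i\<close> and \<open>Q\<^sub>j\<close> on two crossing lines of the flat and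
  \<open>M\<^sub>i\<^sub>j\<close> very close to \<open>P\<^sub>i\<close>. Hence every family of binary relations on \<open>\<nat>\<close> is coded by sets of
  marker points: \<open>r i j\<close> holds iff some marker of \<open>r\<close> lies between \<open>P\<^sub>i\<close> and \<open>Q\<^sub>j\<close>.

  Evaluation of a fixed recursive function is the least model of finitely many Horn rules about
  binary relations between lists and numbers. So the sentence ``if the coded relations satisfy
  the rules, then \<open>x\<close> is accepted'' is universally valid if the computation halts with
  value 1 for some second argument, and otherwise it is refuted by the coding of the standard
  model. This needs no axioms making the coded structure functional or finite.
\<close>

subsection \<open>Segments with private markers\<close>

lemma btw_iff_closed_segment:
  fixes s t u :: "'a::euclidean_space"
  shows "btw s t u \<longleftrightarrow> t \<in> closed_segment s u"
  by (simp add: btw_def flip: between between_mem_segment)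

lemma flat_1_iff:
  "flat 1 (F :: 'a::euclidean_space set) \<longleftrightarrow> (\<exists>a v. v \<noteq> 0 \<and> F = range (\<lambda>r. a + r *\<^sub>R v))"
proof
  assume "flat 1 F"
  then obtain a and v :: "nat \<Rightarrow> 'a" where v: "independent (v ` {..<1})"
    and F: "F = {a + (\<Sum>i<1. r i *\<^sub>R v i) | r :: nat \<Rightarrow> real. True}"
    unfolding flat_def by blast
  have "{..<1::nat} = {0}" by auto
  with v have "v 0 \<noteq> 0" by auto
  moreover have "F = range (\<lambda>r. a + r *\<^sub>R v 0)"
    unfolding F by (auto intro: exI[of _ "\<lambda>_. r" for r])
  ultimately show "\<exists>a v. v \<noteq> 0 \<and> F = range (\<lambda>r. a + r *\<^sub>R v)" by blast
next
  assume "\<exists>a v. v \<noteq> 0 \<and> F = range (\<lambda>r. a + r *\<^sub>R v)"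
  then obtain a v where v: "v \<noteq> 0" "F = range (\<lambda>r. a + r *\<^sub>R v)" by blast
  have "{..<1::nat} = {0}" by auto
  with v show "flat 1 F"
    unfolding flat_def
    by (intro exI[of _ a] exI[of _ "\<lambda>_. v"]) (auto intro: exI[of _ "\<lambda>_. r" for r])
qed

lemma btw_on_line:
  fixes a v :: "'a::euclidean_space"
  assumes "v \<noteq> 0"
  shows "btw (a + p *\<^sub>R v) (a + q *\<^sub>R v) (a + r *\<^sub>R v) \<longleftrightarrow> p \<le> q \<and> q \<le> r \<or> r \<le> q \<and> q \<le> p"
proof -
  have d: "dist (a + x *\<^sub>R v) (a + y *\<^sub>R v) = \<bar>x - y\<bar> * norm v" for x y :: real
    by (simp add: dist_norm flip: scaleR_diff_left)
  have "btw (a + p *\<^sub>R v) (a + q *\<^sub>R v) (a + r *\<^sub>R v) \<longleftrightarrow>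
      \<bar>p - r\<bar> * norm v = (\<bar>p - q\<bar> + \<bar>q - r\<bar>) * norm v"
    unfolding btw_def d by (simp add: distrib_right)
  also have "\<dots> \<longleftrightarrow> \<bar>p - r\<bar> = \<bar>p - q\<bar> + \<bar>q - r\<bar>"
    using assms by simp
  also have "\<dots> \<longleftrightarrow> p \<le> q \<and> q \<le> r \<or> r \<le> q \<and> q \<le> p"
    by linarith
  finally show ?thesis .
qed

text \<open>Since \<open>p \<noteq> q\<close>, the middle point is a convex combination in which
  \<open>u\<close> has nonzero weight \<open>t\<close>; solving for \<open>u\<close> gives its
  parameter on the line.\<close>

lemma btw_extend_on_line:
  fixes a v :: "'a::euclidean_space"
  assumes "btw (a + p *\<^sub>R v) (a + q *\<^sub>R v) u" "p \<noteq> q" "v \<noteq> 0"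
  shows "u \<in> range (\<lambda>r. a + r *\<^sub>R v)"
proof -
  obtain t where t: "a + q *\<^sub>R v = (1 - t) *\<^sub>R (a + p *\<^sub>R v) + t *\<^sub>R u"
    using assms by (auto simp: btw_iff_closed_segment in_segment)
  with assms have t0: "t \<noteq> 0" by auto
  have "t *\<^sub>R u = t *\<^sub>R (a + (p + (q - p) / t) *\<^sub>R v)"
  proof -
    have "t *\<^sub>R u = a + q *\<^sub>R v - (1 - t) *\<^sub>R (a + p *\<^sub>R v)"
      using t by simp
    also have "\<dots> = t *\<^sub>R a + (t * p + (q - p)) *\<^sub>R v"
      by (simp add: algebra_simps)
    also have "\<dots> = t *\<^sub>R (a + (p + (q - p) / t) *\<^sub>R v)"
      using t0 by (simp add: scaleR_add_right distrib_left)
    finally show ?thesis .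
  qed
  then show ?thesis using t0 by auto
qed

section \<open>Points on the lines of a linearly complete set\<close>

text \<open>The trace of \<open>S\<close> on the Euclidean line through \<open>a\<close> and
  \<open>a + v\<close> is a line in \<open>S\<close>. Linear completeness, applied to the midpoint
  of the parameter interval with half its length as tolerance, then yields the point.\<close>

lemma complete_line_dense:
  fixes S :: "'a::euclidean_space set"
  assumes S: "linearly_complete S" and a: "a \<in> S" "a + v \<in> S" "v \<noteq> 0" and pq: "p < q"
  obtains r where "p < r" "r < q" "a + r *\<^sub>R v \<in> S"
proof -
  define F where "F = range (\<lambda>r. a + r *\<^sub>R v)"
  have F: "a \<in> F" "a + v \<in> F"
    unfolding F_def by (auto intro: range_eqI[of _ _ 0] range_eqI[of _ _ 1])
  have coll: "collinear3 s t u" if "s \<in> F" "t \<in> F" "u \<in> F" for s t u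
    using that btw_on_line[OF a(3), of a] unfolding F_def collinear3_def
    by (auto simp: image_iff)
  have ext: "u \<in> F" if "s \<in> F" "t \<in> F" "s \<noteq> t" "btw s u t \<or> btw s t u" for s t u
  proof -
    obtain x y where xy: "s = a + x *\<^sub>R v" "t = a + y *\<^sub>R v"
      using \<open>s \<in> F\<close> \<open>t \<in> F\<close> unfolding F_def by auto
    with \<open>s \<noteq> t\<close> have "x \<noteq> y" by auto
    show ?thesis
      using \<open>btw s u t \<or> btw s t u\<close>
    proof
      assume "btw s u t"
      then obtain z where "u = (1 - z) *\<^sub>R s + z *\<^sub>R t"
        by (auto simp: btw_iff_closed_segment in_segment)
      then have "u = a + ((1 - z) * x + z * y) *\<^sub>R v"
        by (simp add: xy algebra_simps)
      then show ?thesis unfolding F_def by blast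
    next
      assume "btw s t u"
      then show ?thesis
        using btw_extend_on_line[of a x v y u] \<open>x \<noteq> y\<close> a(3) xy unfolding F_def by blast
    qed
  qed
  have "line_in S (S \<inter> F)"
    unfolding line_in_def
  proof (intro conjI ballI impI)
    show "\<exists>s\<in>S \<inter> F. \<exists>t\<in>S \<inter> F. s \<noteq> t"
      using F a by (intro bexI[of _ a] bexI[of _ "a + v"]) auto
  qed (use coll ext in blast)+
  moreover have "flat 1 F"
    unfolding flat_1_iff F_def using a(3) by blast
  moreover have "a + ((p + q) / 2) *\<^sub>R v \<in> F"
    unfolding F_def by blast
  moreover have "(q - p) / 2 * norm v > 0"
    using pq a(3) by simp
  ultimately have "\<exists>s\<in>S \<inter> F. dist s (a + ((p + q) / 2) *\<^sub>R v) < (q - p) / 2 * norm v"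
    using S unfolding linearly_complete_def by blast
  then obtain r where r: "a + r *\<^sub>R v \<in> S"
    and "dist (a + r *\<^sub>R v) (a + ((p + q) / 2) *\<^sub>R v) < (q - p) / 2 * norm v"
    unfolding F_def by blast
  then have "\<bar>r - (p + q) / 2\<bar> * norm v < (q - p) / 2 * norm v"
    by (simp add: dist_norm flip: scaleR_diff_left)
  then have "\<bar>r - (p + q) / 2\<bar> < (q - p) / 2"
    using a(3) by simp
  then have "p < r \<and> r < q"
    unfolding abs_less_iff by (simp add: field_simps)
  then show ?thesis using that r by blast
qed

text \<open>One parameter is picked between each two consecutive levels \<open>l i\<close>, which
  rise from \<open>\<eta> / 2\<close> towards \<open>\<eta>\<close>. That any two parameters differ
  by a factor below 2 is used later to bound weights on crossing segments.\<close>

lemma complete_line_sequence: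
  fixes S :: "'a::euclidean_space set"
  assumes S: "linearly_complete S" and a: "a \<in> S" "a + v \<in> S" "v \<noteq> 0" and \<eta>: "0 < (\<eta>::real)"
  obtains s :: "nat \<Rightarrow> real"
  where "\<And>i. a + s i *\<^sub>R v \<in> S" "\<And>i. \<eta> / 2 < s i" "\<And>i. s i < \<eta>" "strict_mono s"
proof -
  define l where "l i = \<eta> - \<eta> / (real i + 2)" for i :: nat
  have l: "l i < l (Suc i)" "\<eta> / 2 \<le> l i" "l i < \<eta>" for i
    using \<eta> by (auto simp: l_def field_simps)
  have "\<exists>r. l i < r \<and> r < l (Suc i) \<and> a + r *\<^sub>R v \<in> S" for i
    using complete_line_dense[OF S a l(1)] by blast
  then obtain s where s: "\<And>i. l i < s i" "\<And>i. s i < l (Suc i)" "\<And>i. a + s i *\<^sub>R v \<in> S"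
    by metis
  have "strict_mono s"
    unfolding strict_mono_Suc_iff using s(1,2) less_trans by meson
  moreover have "\<eta> / 2 < s i" "s i < \<eta>" for i
    using s(1)[of i] s(2)[of i] l(2)[of i] l(3)[of "Suc i"] by linarith+
  ultimately show ?thesis using that s(3) by blast
qed

lemma strict_mono_isolated:
  fixes s :: "nat \<Rightarrow> real"
  assumes "strict_mono s"
  obtains d where "d > 0" "\<And>k. \<bar>s k - s i\<bar> < d \<Longrightarrow> k = i"
proof -
  \<comment> \<open>This is the distance to the nearer neighbour. Index \<open>0\<close> has no left
    neighbour and \<open>i - 1\<close> would be \<open>0\<close> again, so the default
    \<open>1\<close> keeps the distance positive.\<close>
  define d where "d = min (s (Suc i) - s i) (if i = 0 then 1 else s i - s (i - 1))"
  have "d > 0"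
    using strict_monoD[OF assms, of i "Suc i"] strict_monoD[OF assms, of "i - 1" i]
    by (simp add: d_def)
  moreover have "k = i" if "\<bar>s k - s i\<bar> < d" for k
  proof (rule linorder_cases[of k i])
    assume "k < i"
    then have "s k \<le> s (i - 1)"
      using strict_mono_less_eq[OF assms] by simp
    with that \<open>k < i\<close> show ?thesis by (auto simp: d_def)
  next
    assume "i < k"
    then have "s (Suc i) \<le> s k"
      using strict_mono_less_eq[OF assms] by simp
    with that show ?thesis by (auto simp: d_def)
  qed
  ultimately show ?thesis using that by blast
qed

text \<open>No Euclidean line contains \<open>S\<close>. Hence there is a point \<open>b\<close> of
  \<open>S\<close> off some line through \<open>x\<close>, and then a point \<open>c\<close> of
  \<open>S\<close> off the line through \<open>x\<close> and \<open>b\<close>; the vectors are the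
  differences to \<open>x\<close>.\<close>

lemma linearly_regular_2_noncollinear:
  fixes S :: "'a::euclidean_space set"
  assumes S: "linearly_regular_flat 2 S" and x: "x \<in> S"
  obtains v w where "x + v \<in> S" "x + w \<in> S" "v \<noteq> 0" "\<And>r. w \<noteq> r *\<^sub>R v"
proof -
  have no: "\<not> S \<subseteq> range (\<lambda>r. x + r *\<^sub>R v)" if "v \<noteq> 0" for v
  proof -
    have "flat 1 (range (\<lambda>r. x + r *\<^sub>R v))"
      unfolding flat_1_iff using that by blast
    moreover have "\<not> (\<exists>F. flat 1 F \<and> S \<subseteq> F)"
      using S unfolding linearly_regular_flat_def by (simp add: numeral_2_eq_2)
    ultimately show ?thesis by blast
  qed
  obtain u :: 'a where "u \<noteq> 0"
    using nonempty_Basis nonzero_Basis by blast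
  from no[OF this] obtain b where b: "b \<in> S" "b \<notin> range (\<lambda>r. x + r *\<^sub>R u)" by blast
  from b(2) have "b \<noteq> x + 0 *\<^sub>R u" by blast
  then have "b - x \<noteq> 0" by simp
  from no[OF this] obtain c where c: "c \<in> S" "c \<notin> range (\<lambda>r. x + r *\<^sub>R (b - x))" by blast
  have "c - x \<noteq> r *\<^sub>R (b - x)" for r
    using c(2) by (auto simp: image_iff algebra_simps dest: spec[of _ r])
  then show ?thesis using that[of "b - x" "c - x"] b c \<open>b - x \<noteq> 0\<close> by simp
qed

section \<open>Construction of the point configuration\<close>

text \<open>In the coordinates \<open>v\<close>, \<open>w\<close> about \<open>x\<close>,
  \<open>P k\<close> is \<open>(s k, 0)\<close>, \<open>Q l\<close> is \<open>(0, t l)\<close> and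
  \<open>M i j\<close> is \<open>((1 - r i j) * s i, r i j * t j)\<close>. If \<open>M i j\<close>
  lies on the segment from \<open>P k\<close> to \<open>Q l\<close> with weight \<open>u\<close>,
  the second coordinate forces \<open>u < 2 * r i j\<close>. By the first coordinate
  \<open>s k\<close> is then so near to \<open>s i\<close> that \<open>k = i\<close>; hence
  \<open>u = r i j\<close> and \<open>t l = t j\<close>.\<close>

lemma regular_flat_configuration:
  fixes T :: "'a::euclidean_space set"
  assumes "extends_linearly 2 T"
  obtains P Q :: "nat \<Rightarrow> 'a" and M :: "nat \<Rightarrow> nat \<Rightarrow> 'a"
  where "\<And>i. P i \<in> T" "\<And>i. Q i \<in> T" "\<And>i j. M i j \<in> T"
    "\<And>i j k l. btw (P k) (M i j) (Q l) \<longleftrightarrow> k = i \<and> l = j"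
proof -
  obtain S \<epsilon> x where S: "linearly_regular_flat 2 S" and \<epsilon>: "\<epsilon> > 0" and x: "x \<in> S"
    and ball: "\<And>u. u \<in> S \<Longrightarrow> dist x u < \<epsilon> \<Longrightarrow> u \<in> T"
    using assms unfolding extends_linearly_def by blast
  have compl: "linearly_complete S"
    using S by (simp add: linearly_regular_flat_def)
  obtain v w where vw: "x + v \<in> S" "x + w \<in> S" "v \<noteq> 0" "\<And>r. w \<noteq> r *\<^sub>R v"
    using linearly_regular_2_noncollinear[OF S x] by blast
  from vw(4)[of 0] have "w \<noteq> 0" by simp
  have indep: "p = p' \<and> q = q'" if "p *\<^sub>R v + q *\<^sub>R w = p' *\<^sub>R v + q' *\<^sub>R w" for p q p' q'
  proof -
    have eq: "(q - q') *\<^sub>R w = (p' - p) *\<^sub>R v"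
      using that by (simp add: algebra_simps)
    have "q = q'"
    proof (rule ccontr)
      assume "q \<noteq> q'"
      with eq have "w = ((p' - p) / (q - q')) *\<^sub>R v"
        by (metis eq_vector_fraction_iff right_minus_eq)
      with vw(4) show False by blast
    qed
    with eq vw(3) show ?thesis by simp
  qed
  \<comment> \<open>With this choice every point with a coefficient in \<open>(0, \<eta>)\<close>
    along \<open>v\<close> or along \<open>w\<close> lies in the ball about \<open>x\<close>, and by
    convexity so do the segments between such points.\<close>
  define \<eta> where "\<eta> = \<epsilon> / (norm v + norm w)"
  have nvw: "norm v + norm w > 0" using vw(3) by (simp add: add_pos_nonneg)
  then have \<eta>: "\<eta> > 0" using \<epsilon> by (simp add: \<eta>_def)
  have \<eta>\<epsilon>: "\<eta> * norm v + \<eta> * norm w = \<epsilon>"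
    unfolding \<eta>_def distrib_left[symmetric] using nvw by simp
  obtain s :: "nat \<Rightarrow> real" where s: "\<And>i. x + s i *\<^sub>R v \<in> S" "\<And>i. \<eta> / 2 < s i" "\<And>i. s i < \<eta>" "strict_mono s"
    using complete_line_sequence[OF compl x vw(1,3) \<eta>] by blast
  obtain t :: "nat \<Rightarrow> real" where t: "\<And>i. x + t i *\<^sub>R w \<in> S" "\<And>i. \<eta> / 2 < t i" "\<And>i. t i < \<eta>" "strict_mono t"
    using complete_line_sequence[OF compl x vw(2) \<open>w \<noteq> 0\<close> \<eta>] by blast
  have st: "0 < s i" "0 < t i" for i
    using s(2)[of i] t(2)[of i] \<eta> by linarith+
  have "\<exists>d>0. \<forall>k. \<bar>s k - s i\<bar> < d \<longrightarrow> k = i" for i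
    using strict_mono_isolated[OF s(4), of i] by blast
  then obtain d where d: "\<And>i. d i > 0" "\<And>i k. \<bar>s k - s i\<bar> < d i \<Longrightarrow> k = i"
    by metis
  \<comment> \<open>The bound \<open>1\<close> keeps the marker inside its segment; the bound
    \<open>d i / (2 * \<eta>)\<close> makes the possible difference between \<open>s k\<close> and
    \<open>s i\<close> smaller than the isolation distance \<open>d i\<close>.\<close>
  have "\<exists>r>0. r < min 1 (d i / (2 * \<eta>)) \<and> (x + s i *\<^sub>R v) + r *\<^sub>R (t j *\<^sub>R w - s i *\<^sub>R v) \<in> S" for i j
  proof -
    have "t j *\<^sub>R w - s i *\<^sub>R v \<noteq> 0"
      using indep[of 0 "t j" "s i" 0] st[of i] by auto
    moreover have "(x + s i *\<^sub>R v) + (t j *\<^sub>R w - s i *\<^sub>R v) \<in> S"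
      using t(1)[of j] by simp
    moreover have "0 < min 1 (d i / (2 * \<eta>))"
      using d(1) \<eta> by simp
    ultimately show ?thesis
      using complete_line_dense[OF compl s(1)] by blast
  qed
  then obtain r where r: "\<And>i j. r i j > 0" "\<And>i j. r i j < min 1 (d i / (2 * \<eta>))"
    "\<And>i j. (x + s i *\<^sub>R v) + r i j *\<^sub>R (t j *\<^sub>R w - s i *\<^sub>R v) \<in> S"
    by metis
  have r': "r i j < 1" "2 * r i j * \<eta> < d i" for i j
    using r(2)[of i j] \<eta> by (auto simp: field_simps)
  define P where "P i = x + s i *\<^sub>R v" for i
  define Q where "Q j = x + t j *\<^sub>R w" for j
  define M where "M i j = (1 - r i j) *\<^sub>R P i + r i j *\<^sub>R Q j" for i j
  have M_eq: "M i j = (x + s i *\<^sub>R v) + r i j *\<^sub>R (t j *\<^sub>R w - s i *\<^sub>R v)" for i j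
    by (simp add: M_def P_def Q_def algebra_simps)
  have P_ball: "P i \<in> ball x \<epsilon>" for i
  proof -
    have "norm (s i *\<^sub>R v) \<le> \<eta> * norm v" using s(3)[of i] st[of i] by (simp add: mult_right_mono)
    also have "\<dots> < \<epsilon>" using \<eta>\<epsilon> \<eta> \<open>w \<noteq> 0\<close> by (smt (verit) mult_pos_pos zero_less_norm_iff)
    finally show ?thesis by (simp add: P_def dist_norm)
  qed
  have Q_ball: "Q i \<in> ball x \<epsilon>" for i
  proof -
    have "norm (t i *\<^sub>R w) \<le> \<eta> * norm w" using t(3)[of i] st[of i] by (simp add: mult_right_mono)
    also have "\<dots> < \<epsilon>" using \<eta>\<epsilon> \<eta> vw(3) by (smt (verit) mult_pos_pos zero_less_norm_iff)
    finally show ?thesis by (simp add: Q_def dist_norm)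
  qed
  have M_seg: "M i j \<in> closed_segment (P i) (Q j)" for i j
    unfolding in_segment M_def using r(1)[of i j] r'(1)[of i j] by (auto intro!: exI[of _ "r i j"])
  have M_ball: "M i j \<in> ball x \<epsilon>" for i j
    using M_seg closed_segment_subset[OF P_ball Q_ball convex_ball] by blast
  have in_S: "P i \<in> S" "Q i \<in> S" "M i j \<in> S" for i j
    unfolding M_eq using s(1) t(1) r(3) by (simp_all only: P_def Q_def)
  have comb: "(1 - z) *\<^sub>R (x + a *\<^sub>R v) + z *\<^sub>R (x + b *\<^sub>R w) =
      x + (((1 - z) * a) *\<^sub>R v + (z * b) *\<^sub>R w)" for z a b
    by (simp add: algebra_simps)
  show ?thesis
  proof (rule that)
    show "P i \<in> T" "Q i \<in> T" "M i j \<in> T" for i j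
      using ball P_ball[of i] Q_ball[of i] M_ball[of i j] in_S
      unfolding mem_ball by blast+
    fix i j k l
    have "k = i \<and> l = j" if "M i j \<in> closed_segment (P k) (Q l)"
    proof -
      from that obtain u where u: "0 \<le> u" "u \<le> 1" "M i j = (1 - u) *\<^sub>R P k + u *\<^sub>R Q l"
        by (auto simp: in_segment)
      have "x + (((1 - r i j) * s i) *\<^sub>R v + (r i j * t j) *\<^sub>R w) =
            x + (((1 - u) * s k) *\<^sub>R v + (u * t l) *\<^sub>R w)"
        using u(3) unfolding M_def P_def Q_def comb .
      then have "((1 - r i j) * s i) *\<^sub>R v + (r i j * t j) *\<^sub>R w =
            ((1 - u) * s k) *\<^sub>R v + (u * t l) *\<^sub>R w"
        by (rule add_left_imp_eq)
      from indep[OF this] have eq: "(1 - r i j) * s i = (1 - u) * s k" "r i j * t j = u * t l"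
        by blast+
      \<comment> \<open>As \<open>t l\<close> exceeds \<open>\<eta> / 2\<close> and
        \<open>t j\<close> is below \<open>\<eta>\<close>, equality of the second coordinates gives
        \<open>u < 2 * r i j\<close>.\<close>
      have "u * (\<eta> / 2) \<le> u * t l"
        using u(1) t(2)[of l] by (intro mult_left_mono) auto
      also have "\<dots> < r i j * \<eta>"
        unfolding eq(2)[symmetric] using t(3)[of j] r(1)[of i j] by (rule mult_strict_left_mono)
      finally have "u * \<eta> < 2 * r i j * \<eta>" by simp
      moreover have "u * s k \<le> u * \<eta>"
        using u(1) s(3)[of k] by (intro mult_left_mono) auto
      moreover have "r i j * s i < 2 * r i j * \<eta>"
        using mult_strict_left_mono[OF s(3)[of i] r(1)[of i j]] mult_pos_pos[OF r(1)[of i j] \<eta>]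
        by linarith
      moreover have "0 < r i j * s i" "0 \<le> u * s k"
        using r(1)[of i j] st(1)[of i] st(1)[of k] u(1) by simp_all
      \<comment> \<open>Both terms on the right lie between \<open>0\<close> and
        \<open>2 * r i j * \<eta>\<close>, which is below \<open>d i\<close>.\<close>
      moreover have "s k - s i = u * s k - r i j * s i"
        using eq(1) by (simp add: algebra_simps)
      ultimately have "\<bar>s k - s i\<bar> < d i"
        using r'(2)[of i j] by linarith
      then have "k = i" by (rule d(2))
      with eq(1) st(1)[of i] have "r i j = u" by simp
      with eq(2) r(1)[of i j] have "t j = t l" by simp
      then have "j = l" using t(4) by (simp add: strict_mono_eq)
      with \<open>k = i\<close> show ?thesis by simp
    qed
    then show "btw (P k) (M i j) (Q l) \<longleftrightarrow> k = i \<and> l = j"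
      using M_seg by (auto simp: btw_iff_closed_segment)
  qed
qed

subsection \<open>Evaluation as a Horn theory of binary relations\<close>

text \<open>\<open>CEval f\<close> relates an argument list to a value, \<open>CEvals gs\<close> an
  argument list to the list of values. \<open>CZero\<close>, \<open>CMu f\<close> and
  \<open>CAcc p\<close> stand for unary properties and occur in the rules only on the
  diagonal.\<close>

datatype colour = CZero | CSuc | CHd | CTl | CEval recf | CEvals "recf list" | CMu recf | CAcc recf

instance recf :: countable by countable_datatype
instance colour :: countable by countable_datatype

type_synonym atom = "colour \<times> nat \<times> nat"
type_synonym rule = "nat \<times> atom list \<times> atom list"

definition atoms_hold :: "(colour \<Rightarrow> 'a \<Rightarrow> 'a \<Rightarrow> bool) \<Rightarrow> (nat \<Rightarrow> 'a) \<Rightarrow> atom list \<Rightarrow> bool" where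
  "atoms_hold h e as \<longleftrightarrow> (\<forall>(c, x, y)\<in>set as. h c (e x) (e y))"

text \<open>
  In a rule \<open>(n, body, head)\<close> the variables below \<open>n\<close> are universally quantified and the
  variable \<open>n\<close> is existentially quantified in the head.
\<close>

definition rule_holds :: "'a set \<Rightarrow> (colour \<Rightarrow> 'a \<Rightarrow> 'a \<Rightarrow> bool) \<Rightarrow> rule \<Rightarrow> bool" where
  "rule_holds D h = (\<lambda>(n, body, head). \<forall>e. (\<forall>i<n. e i \<in> D) \<longrightarrow> atoms_hold h e body \<longrightarrow>
     (\<exists>a\<in>D. atoms_hold h (e(n := a)) head))"

definition rule_wf :: "rule \<Rightarrow> bool" where
  "rule_wf = (\<lambda>(n, body, head). (\<forall>(c, x, y)\<in>set body. x < n \<and> y < n) \<and>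
     (\<forall>(c, x, y)\<in>set head. x \<le> n \<and> y \<le> n))"

lemma atoms_hold_simps [simp]:
  "atoms_hold h e []"
  "atoms_hold h e ((c, x, y) # as) \<longleftrightarrow> h c (e x) (e y) \<and> atoms_hold h e as"
  by (auto simp: atoms_hold_def)

lemma atoms_hold_cong:
  assumes "\<And>c x y. (c, x, y) \<in> set as \<Longrightarrow> e x = e' x \<and> e y = e' y"
  shows "atoms_hold h e as \<longleftrightarrow> atoms_hold h e' as"
  unfolding atoms_hold_def using assms by fastforce

text \<open>Choosing an index for each value of the assignment pulls the rule back to
  \<open>r\<close>. Well-formedness confines body and head to the variables with a chosen index and
  the witness.\<close>

lemma rule_holds_transport:
  assumes h: "\<And>c i j. h c (P i) (P j) \<longleftrightarrow> r c i j"
    and wf: "rule_wf \<rho>" and r: "rule_holds UNIV r \<rho>"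
  shows "rule_holds (range P) h \<rho>"
proof -
  obtain n body head where \<rho>: "\<rho> = (n, body, head)"
    by (cases \<rho>)
  have trans: "atoms_hold h (\<lambda>i. P (k i)) as \<longleftrightarrow> atoms_hold r k as" for k as
    by (simp add: atoms_hold_def h)
  show ?thesis
    unfolding rule_holds_def \<rho> prod.case
  proof (intro allI impI)
    fix e
    assume e: "\<forall>i<n. e i \<in> range P" and body: "atoms_hold h e body"
    from e have "\<forall>i. \<exists>k. i < n \<longrightarrow> e i = P k" by blast
    then obtain k where k: "\<And>i. i < n \<Longrightarrow> e i = P (k i)" by metis
    have "atoms_hold h e body \<longleftrightarrow> atoms_hold h (\<lambda>i. P (k i)) body"
      using wf k by (intro atoms_hold_cong) (force simp: \<rho> rule_wf_def)
    with body obtain a where a: "atoms_hold r (k(n := a)) head"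
      using r by (auto simp: \<rho> rule_holds_def trans)
    have "atoms_hold h (e(n := P a)) head \<longleftrightarrow> atoms_hold h (\<lambda>i. P ((k(n := a)) i)) head"
      using wf k by (intro atoms_hold_cong) (force simp: \<rho> rule_wf_def)
    also have "\<dots> \<longleftrightarrow> atoms_hold r (k(n := a)) head" by (rule trans)
    finally show "\<exists>a\<in>range P. atoms_hold h (e(n := a)) head"
      using a by blast
  qed
qed

section \<open>Horn rules for recursive functions\<close>

text \<open>These are the only rules whose heads use the existential variable. They supply a zero,
  successors and list cells, without claiming uniqueness.\<close>

definition base_rules :: "rule list" where
  "base_rules =
    [(0, [], [(CZero, 0, 0)]),
     (1, [], [(CSuc, 0, 1)]),
     (2, [], [(CHd, 2, 0), (CTl, 2, 1)])]"

primrec proj_rules :: "nat \<Rightarrow> rule list" where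
  "proj_rules 0 = [(2, [(CHd, 0, 1)], [(CEval (Proj 0), 0, 1)])]"
| "proj_rules (Suc i) =
    (3, [(CTl, 0, 1), (CEval (Proj i), 1, 2)], [(CEval (Proj (Suc i)), 0, 2)]) # proj_rules i"

primrec evals_rules :: "recf list \<Rightarrow> rule list" where
  "evals_rules [] = [(2, [(CZero, 1, 1)], [(CEvals [], 0, 1)])]"
| "evals_rules (g # gs) =
    (4, [(CEval g, 0, 1), (CEvals gs, 0, 2), (CHd, 3, 1), (CTl, 3, 2)], [(CEvals (g # gs), 0, 3)])
      # evals_rules gs"

text \<open>Every intermediate number and list is a variable of the body, since these rules create
  no elements. \<open>CMu f\<close> at the list \<open>n # xs\<close> records that \<open>f\<close>
  has nonzero values below \<open>n\<close>; being nonzero is stated positively, as being a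
  successor, which keeps the rules Horn.\<close>

primrec eval_rules :: "recf \<Rightarrow> rule list" where
  "eval_rules Zero = [(2, [(CZero, 1, 1)], [(CEval Zero, 0, 1)])]"
| "eval_rules Succ =
    [(4, [(CHd, 0, 1), (CTl, 0, 2), (CZero, 2, 2), (CSuc, 1, 3)], [(CEval Succ, 0, 3)])]"
| "eval_rules (Proj i) = proj_rules i"
| "eval_rules (Comp f gs) =
    (3, [(CEvals gs, 0, 1), (CEval f, 1, 2)], [(CEval (Comp f gs), 0, 2)])
      # evals_rules gs @ eval_rules f @ concat (map eval_rules gs)"
| "eval_rules (Prec f g) =
    (4, [(CHd, 0, 1), (CZero, 1, 1), (CTl, 0, 2), (CEval f, 2, 3)], [(CEval (Prec f g), 0, 3)])
      # (9, [(CHd, 0, 1), (CSuc, 2, 1), (CTl, 0, 3), (CHd, 4, 2), (CTl, 4, 3),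
             (CEval (Prec f g), 4, 5), (CHd, 6, 5), (CTl, 6, 3), (CHd, 7, 2), (CTl, 7, 6),
             (CEval g, 7, 8)], [(CEval (Prec f g), 0, 8)])
      # eval_rules f @ eval_rules g"
| "eval_rules (Mu f) =
    (2, [(CHd, 0, 1), (CZero, 1, 1)], [(CMu f, 0, 0)])
      # (7, [(CMu f, 0, 0), (CHd, 0, 1), (CTl, 0, 2), (CEval f, 0, 3), (CSuc, 4, 3),
             (CSuc, 1, 5), (CHd, 6, 5), (CTl, 6, 2)], [(CMu f, 6, 6)])
      # (4, [(CMu f, 0, 0), (CHd, 0, 1), (CTl, 0, 2), (CEval f, 0, 3), (CZero, 3, 3)],
            [(CEval (Mu f), 2, 1)])
      # eval_rules f"

text \<open>Variable 0 is the list \<open>[x, y]\<close> and variable 6 the number 1. As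
  \<open>y\<close> occurs only in the body, the rule quantifies it existentially.\<close>

definition acc_rule :: "recf \<Rightarrow> rule" where
  "acc_rule p =
    (7, [(CHd, 0, 1), (CTl, 0, 2), (CHd, 2, 3), (CTl, 2, 4), (CZero, 4, 4), (CZero, 5, 5),
         (CSuc, 5, 6), (CEval p, 0, 6)], [(CAcc p, 1, 1)])"

definition all_rules :: "recf \<Rightarrow> rule list" where
  "all_rules p = base_rules @ eval_rules p @ [acc_rule p]"

lemma rule_wf_proj: "\<rho> \<in> set (proj_rules i) \<Longrightarrow> rule_wf \<rho>"
  by (induction i) (auto simp: rule_wf_def)

lemma rule_wf_evals: "\<rho> \<in> set (evals_rules gs) \<Longrightarrow> rule_wf \<rho>"
  by (induction gs) (auto simp: rule_wf_def)

lemma rule_wf_eval: "\<rho> \<in> set (eval_rules f) \<Longrightarrow> rule_wf \<rho>"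
proof (induction f)
  case (Comp f gs)
  then show ?case by (auto dest: rule_wf_evals) (simp add: rule_wf_def)
next
  case (Prec f g)
  then show ?case by (auto) (simp_all add: rule_wf_def)
next
  case (Mu f)
  then show ?case by (auto) (simp_all add: rule_wf_def)
qed (auto dest: rule_wf_proj, auto simp: rule_wf_def)

lemma rule_wf_all: "\<rho> \<in> set (all_rules p) \<Longrightarrow> rule_wf \<rho>"
  by (auto simp: all_rules_def dest: rule_wf_eval) (auto simp: base_rules_def acc_rule_def rule_wf_def)

text \<open>
  In the standard model each natural number stands both for itself and for the list it encodes;
  in particular \<open>CZero\<close> also marks the empty list.
\<close>

primrec std :: "colour \<Rightarrow> nat \<Rightarrow> nat \<Rightarrow> bool" where
  "std CZero i j \<longleftrightarrow> i = 0 \<and> j = 0"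
| "std CSuc i j \<longleftrightarrow> j = Suc i"
| "std CHd i j \<longleftrightarrow> (\<exists>xs. list_decode i = j # xs)"
| "std CTl i j \<longleftrightarrow> (\<exists>x. list_decode i = x # list_decode j)"
| "std (CEval f) i j \<longleftrightarrow> rec_eval f (list_decode i) j"
| "std (CEvals gs) i j \<longleftrightarrow> list_all2 (\<lambda>g y. rec_eval g (list_decode i) y) gs (list_decode j)"
| "std (CMu f) i j \<longleftrightarrow> (\<exists>n xs. list_decode i = n # xs \<and> (\<forall>m<n. \<exists>y. rec_eval f (m # xs) (Suc y)))"
| "std (CAcc p) i j \<longleftrightarrow> (\<exists>y. rec_eval p [i, y] 1)"

section \<open>Soundness of the rules in the standard model\<close>

lemma std_proj: "\<rho> \<in> set (proj_rules i) \<Longrightarrow> rule_holds UNIV std \<rho>"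
proof (induction i)
  case 0
  have "rec_eval (Proj 0) (x # xs) x" for x xs
    using rec_eval.proj[of 0 "x # xs"] by simp
  with 0 show ?case by (auto simp: rule_holds_def)
next
  case (Suc i)
  have "rec_eval (Proj (Suc i)) (x # xs) y" if "rec_eval (Proj i) xs y" for x xs y
    using that rec_eval.proj[of "Suc i" "x # xs"] by (auto elim!: rec_eval_elims)
  with Suc show ?case by (auto simp: rule_holds_def)
qed

lemma std_evals: "\<rho> \<in> set (evals_rules gs) \<Longrightarrow> rule_holds UNIV std \<rho>"
  by (induction gs) (auto simp: rule_holds_def)

lemma std_eval: "\<rho> \<in> set (eval_rules f) \<Longrightarrow> rule_holds UNIV std \<rho>"
proof (induction f)
  case (Comp f gs)
  then show ?case
    by (auto dest: std_evals) (auto simp: rule_holds_def intro: rec_eval.comp)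
next
  case (Prec f g)
  then show ?case
    by auto (auto simp: rule_holds_def intro: rec_eval.prec_0, metis rec_eval.prec_Suc)
next
  case (Mu f)
  then show ?case
    by auto (auto simp: rule_holds_def less_Suc_eq intro: rec_eval.mu)
qed (auto dest: std_proj, auto simp: rule_holds_def intro: rec_eval.intros)

lemma std_all: "\<rho> \<in> set (all_rules p) \<Longrightarrow> rule_holds UNIV std \<rho>"
proof -
  \<comment> \<open>This is the existence of list cells; the witness is the code of the extended
    list.\<close>
  have "\<exists>a. (\<exists>ys. list_decode a = x # ys) \<and> (\<exists>y. list_decode a = y # list_decode xs)" for x xs
    by (intro exI[of _ "list_encode (x # list_decode xs)"]) (simp del: list_encode.simps)
  then show "\<rho> \<in> set (all_rules p) \<Longrightarrow> rule_holds UNIV std \<rho>"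
  by (auto simp: all_rules_def dest: std_eval)
     (auto simp: base_rules_def acc_rule_def rule_holds_def)
qed

section \<open>Evaluation in an arbitrary model of the rules\<close>

text \<open>The model may have nonstandard elements and several successors or codes of one list.
  \<open>num\<close> and \<open>lst\<close> choose one representative each, and
  \<open>lst []\<close> is \<open>num 0\<close> because \<open>CZero\<close> also marks the empty
  list.\<close>

locale rule_model =
  fixes D :: "'a set" and h :: "colour \<Rightarrow> 'a \<Rightarrow> 'a \<Rightarrow> bool"
  assumes base: "\<And>\<rho>. \<rho> \<in> set base_rules \<Longrightarrow> rule_holds D h \<rho>"
begin

primrec num :: "nat \<Rightarrow> 'a" where
  "num 0 = (SOME a. a \<in> D \<and> h CZero a a)"
| "num (Suc n) = (SOME a. a \<in> D \<and> h CSuc (num n) a)"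

primrec lst :: "nat list \<Rightarrow> 'a" where
  "lst [] = num 0"
| "lst (x # xs) = (SOME a. a \<in> D \<and> h CHd a (num x) \<and> h CTl a (lst xs))"

lemma num_0: "num 0 \<in> D \<and> h CZero (num 0) (num 0)"
proof -
  have "rule_holds D h (0, [], [(CZero, 0, 0)])"
    by (rule base) (simp add: base_rules_def)
  then have "\<exists>a. a \<in> D \<and> h CZero a a"
    by (auto simp: rule_holds_def)
  then show ?thesis unfolding num.simps by (rule someI_ex)
qed

lemma num_Suc: "num n \<in> D \<Longrightarrow> num (Suc n) \<in> D \<and> h CSuc (num n) (num (Suc n))"
proof -
  assume n: "num n \<in> D"
  have "rule_holds D h (1, [], [(CSuc, 0, 1)])"
    by (rule base) (simp add: base_rules_def)
  from this[unfolded rule_holds_def prod.case, rule_format, of "\<lambda>_. num n"] n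
  have "\<exists>a. a \<in> D \<and> h CSuc (num n) a"
    by auto
  then show ?thesis unfolding num.simps by (rule someI_ex)
qed

lemma num_in [simp]: "num n \<in> D"
  by (induction n) (use num_0 num_Suc in blast)+

lemma lst_Cons:
  "lst xs \<in> D \<Longrightarrow> lst (x # xs) \<in> D \<and> h CHd (lst (x # xs)) (num x) \<and> h CTl (lst (x # xs)) (lst xs)"
proof -
  assume n: "lst xs \<in> D"
  have "rule_holds D h (2, [], [(CHd, 2, 0), (CTl, 2, 1)])"
    by (rule base) (simp add: base_rules_def)
  from this[unfolded rule_holds_def prod.case, THEN spec, of "\<lambda>i. if i = 0 then num x else lst xs"] n
  have "\<exists>a. a \<in> D \<and> h CHd a (num x) \<and> h CTl a (lst xs)"
    by auto
  then show ?thesis unfolding lst.simps by (rule someI_ex)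
qed

lemma lst_in [simp]: "lst xs \<in> D"
  by (induction xs) (use num_0 lst_Cons in auto)

lemma model_simps [simp]:
  "h CZero (num 0) (num 0)"
  "h CSuc (num n) (num (Suc n))"
  "h CHd (lst (x # xs)) (num x)"
  "h CTl (lst (x # xs)) (lst xs)"
  using num_0 num_Suc lst_Cons by simp_all

lemma lst_Nil: "lst [] = num 0"
  by simp

declare num.simps [simp del] lst.simps [simp del]

text \<open>The head mentions only universal variables, so updating variable \<open>n\<close> with
  the witness leaves it unchanged. The list \<open>as\<close> gives the instance of these
  variables.\<close>

lemma fire:
  assumes "rule_holds D h (n, body, [(c, x, y)])" "length as = n" "set as \<subseteq> D"
    "atoms_hold h ((!) as) body" "x < n" "y < n"
  shows "h c (as ! x) (as ! y)"
proof -
  have "\<exists>a\<in>D. atoms_hold h (((!) as)(n := a)) [(c, x, y)]"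
    using assms(1)[unfolded rule_holds_def prod.case, rule_format, of "(!) as"] assms(2-4)
    by (metis nth_mem subsetD)
  then show ?thesis using assms(5,6) by auto
qed

lemma proj_complete:
  assumes "\<forall>\<rho>\<in>set (proj_rules i). rule_holds D h \<rho>" "i < length xs"
  shows "h (CEval (Proj i)) (lst xs) (num (xs ! i))"
  using assms
proof (induction i arbitrary: xs)
  case 0
  then obtain y ys where "xs = y # ys" by (cases xs) auto
  moreover have "rule_holds D h (2, [(CHd, 0, 1)], [(CEval (Proj 0), 0, 1)])"
    using 0 by simp
  ultimately show ?case using fire[of 2 _ _ 0 1 "[lst xs, num y]"] by simp
next
  case (Suc i)
  then obtain y ys where xs: "xs = y # ys" by (cases xs) auto
  have "rule_holds D h
      (3, [(CTl, 0, 1), (CEval (Proj i), 1, 2)], [(CEval (Proj (Suc i)), 0, 2)])"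
    using Suc by simp
  moreover have "h (CEval (Proj i)) (lst ys) (num (ys ! i))"
    using Suc xs by simp
  ultimately show ?case using xs fire[of 3 _ _ 0 2 "[lst xs, lst ys, num (ys ! i)]"] by simp
qed

lemma evals_complete:
  assumes "\<forall>\<rho>\<in>set (evals_rules gs). rule_holds D h \<rho>"
    "list_all2 (\<lambda>g y. h (CEval g) (lst xs) (num y)) gs ys"
  shows "h (CEvals gs) (lst xs) (lst ys)"
  using assms(2,1)
proof (induction rule: list_all2_induct)
  case Nil
  then have "rule_holds D h (2, [(CZero, 1, 1)], [(CEvals [], 0, 1)])" by simp
  from fire[OF this, of "[lst xs, lst []]"] show ?case by (simp add: lst_Nil)
next
  case (Cons g gs y ys)
  then have "rule_holds D h (4, [(CEval g, 0, 1), (CEvals gs, 0, 2), (CHd, 3, 1), (CTl, 3, 2)],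
      [(CEvals (g # gs), 0, 3)])" by simp
  from fire[OF this, of "[lst xs, num y, lst ys, lst (y # ys)]"] Cons
  show ?case by simp
qed

text \<open>Induction on the derivation: each clause of \<open>rec_eval\<close> is matched by rules
  fired on the chosen representatives.\<close>

lemma eval_complete:
  assumes "rec_eval f xs y" "\<forall>\<rho>\<in>set (eval_rules f). rule_holds D h \<rho>"
  shows "h (CEval f) (lst xs) (num y)"
  using assms
proof (induction rule: rec_eval.induct)
  case (zero xs)
  then have "rule_holds D h (2, [(CZero, 1, 1)], [(CEval Zero, 0, 1)])" by simp
  from fire[OF this, of "[lst xs, num 0]"] show ?case by simp
next
  case (succ x)
  then have "rule_holds D h (4, [(CHd, 0, 1), (CTl, 0, 2), (CZero, 2, 2), (CSuc, 1, 3)],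
      [(CEval Succ, 0, 3)])" by simp
  from fire[OF this, of "[lst [x], num x, lst [], num (Suc x)]"] show ?case
    by (simp add: numeral_nat, simp add: lst_Nil)
next
  case (proj i xs)
  then show ?case using proj_complete by simp
next
  case (comp xs gs ys f z)
  have "list_all2 (\<lambda>g y. h (CEval g) (lst xs) (num y)) gs ys"
    using comp.IH(1) comp.prems by (intro list.rel_mono_strong[OF comp.IH(1)]) auto
  then have evals: "h (CEvals gs) (lst xs) (lst ys)"
    using comp.prems by (intro evals_complete) auto
  have "rule_holds D h
      (3, [(CEvals gs, 0, 1), (CEval f, 1, 2)], [(CEval (Comp f gs), 0, 2)])"
    using comp.prems by simp
  from fire[OF this, of "[lst xs, lst ys, num z]"] evals comp show ?case by simp
next
  case (prec_0 f xs y g)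
  then have "rule_holds D h (4, [(CHd, 0, 1), (CZero, 1, 1), (CTl, 0, 2), (CEval f, 2, 3)],
      [(CEval (Prec f g), 0, 3)])" by simp
  from fire[OF this, of "[lst (0 # xs), num 0, lst xs, num y]"] prec_0 show ?case by simp
next
  case (prec_Suc f g n xs y z)
  then have "rule_holds D h
      (9, [(CHd, 0, 1), (CSuc, 2, 1), (CTl, 0, 3), (CHd, 4, 2), (CTl, 4, 3),
             (CEval (Prec f g), 4, 5), (CHd, 6, 5), (CTl, 6, 3), (CHd, 7, 2), (CTl, 7, 6),
             (CEval g, 7, 8)], [(CEval (Prec f g), 0, 8)])" by simp
  from fire[OF this, of "[lst (Suc n # xs), num (Suc n), num n, lst xs, lst (n # xs), num y,
      lst (y # xs), lst (n # y # xs), num z]"] prec_Suc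
  show ?case by simp
next
  case (mu f n xs)
  \<comment> \<open>The search is replayed from \<open>0\<close> up to \<open>n\<close>; each
    nonzero value below \<open>n\<close> licenses one step.\<close>
  have "h (CMu f) (lst (k # xs)) (lst (k # xs))" if "k \<le> n" for k
    using that
  proof (induction k)
    case 0
    have "rule_holds D h (2, [(CHd, 0, 1), (CZero, 1, 1)], [(CMu f, 0, 0)])"
      using mu.prems by simp
    from fire[OF this, of "[lst (0 # xs), num 0]"] show ?case by simp
  next
    case (Suc k)
    from Suc.prems have "k < n" by simp
    from mu.IH(2)[OF this] obtain y where y: "h (CEval f) (lst (k # xs)) (num (Suc y))"
      using mu.prems by auto
    have "rule_holds D h
      (7, [(CMu f, 0, 0), (CHd, 0, 1), (CTl, 0, 2), (CEval f, 0, 3), (CSuc, 4, 3),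
             (CSuc, 1, 5), (CHd, 6, 5), (CTl, 6, 2)], [(CMu f, 6, 6)])"
      using mu.prems by simp
    from fire[OF this, of "[lst (k # xs), num k, lst xs, num (Suc y), num y, num (Suc k),
        lst (Suc k # xs)]"] y Suc
    show ?case by simp
  qed
  then have "h (CMu f) (lst (n # xs)) (lst (n # xs))" by simp
  moreover have "rule_holds D h
      (4, [(CMu f, 0, 0), (CHd, 0, 1), (CTl, 0, 2), (CEval f, 0, 3), (CZero, 3, 3)],
            [(CEval (Mu f), 2, 1)])"
    using mu.prems by simp
  note fire[OF this, of "[lst (n # xs), num n, lst xs, num 0]"]
  ultimately show ?case
    using mu.IH(1) mu.prems by simp
qed

lemma acc_complete:
  assumes "\<And>\<rho>. \<rho> \<in> set (all_rules p) \<Longrightarrow> rule_holds D h \<rho>" "rec_eval p [x, y] 1"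
  shows "h (CAcc p) (num x) (num x)"
proof -
  have "rule_holds D h (acc_rule p)" using assms(1) by (simp add: all_rules_def)
  from fire[OF this[unfolded acc_rule_def], of "[lst [x, y], num x, lst [y], num y, lst [], num 0, num 1]"]
    eval_complete[OF assms(2)] assms(1)
  show ?thesis by (simp add: all_rules_def, simp add: lst_Nil flip: One_nat_def)
qed

end

subsection \<open>Computability of formula codes\<close>

definition computes :: "recf \<Rightarrow> nat \<Rightarrow> (nat list \<Rightarrow> nat) \<Rightarrow> bool" where
  "computes p n f \<longleftrightarrow> (\<forall>xs. length xs = n \<longrightarrow> rec_eval p xs (f xs))"

lemma computes_Proj: "i < n \<Longrightarrow> computes (Proj i) n (\<lambda>xs. xs ! i)"
  by (simp add: computes_def rec_eval.proj)

lemma computes_Comp1: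
  assumes "computes f 1 F" "computes g n G"
  shows "computes (Comp f [g]) n (\<lambda>xs. F [G xs])"
  using assms by (auto simp: computes_def intro!: rec_eval.comp)

lemma computes_Comp2:
  assumes "computes f 2 F" "computes g n G" "computes g' n G'"
  shows "computes (Comp f [g, g']) n (\<lambda>xs. F [G xs, G' xs])"
  using assms by (auto simp: computes_def intro!: rec_eval.comp)

lemma computes_Succ: "computes Succ 1 (\<lambda>xs. Suc (hd xs))"
  by (auto simp: computes_def length_Suc_conv intro: rec_eval.succ)

lemma computes_const: "\<exists>p. computes p n (\<lambda>_. c)"
proof (induction c)
  case 0
  show ?case by (auto simp: computes_def intro: rec_eval.zero)
next
  case (Suc c)
  then obtain p where "computes p n (\<lambda>_. c)" ..
  from computes_Comp1[OF computes_Succ this] show ?case by auto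
qed

lemma computes_Prec:
  assumes f: "computes f n F" and g: "computes g (Suc (Suc n)) G"
    and H: "\<And>xs. length xs = n \<Longrightarrow> H (0 # xs) = F xs"
      "\<And>m xs. length xs = n \<Longrightarrow> H (Suc m # xs) = G (m # H (m # xs) # xs)"
  shows "computes (Prec f g) (Suc n) H"
proof -
  have "rec_eval (Prec f g) (m # xs) (H (m # xs))" if "length xs = n" for m xs
  proof (induction m)
    case 0
    show ?case using f that by (auto simp: H computes_def intro: rec_eval.prec_0)
  next
    case (Suc m)
    then show ?case using g that by (auto simp: H computes_def intro: rec_eval.prec_Suc)
  qed
  then show ?thesis by (auto simp: computes_def length_Suc_conv)
qed

lemma computes_plus: "\<exists>p. computes p 2 (\<lambda>xs. xs ! 0 + xs ! 1)"
proof -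
  have "computes (Prec (Proj 0) (Comp Succ [Proj 1])) (Suc 1) (\<lambda>xs. xs ! 0 + xs ! 1)"
    by (rule computes_Prec[OF computes_Proj computes_Comp1[OF computes_Succ computes_Proj]]) auto
  then show ?thesis by (auto simp: numeral_2_eq_2)
qed

lemma computes_triangle: "\<exists>p. computes p 1 (\<lambda>xs. triangle (xs ! 0))"
proof -
  obtain add where add: "computes add 2 (\<lambda>xs. xs ! 0 + xs ! 1)" using computes_plus ..
  have "computes (Prec Zero (Comp add [Proj 1, Comp Succ [Proj 0]])) (Suc 0) (\<lambda>xs. triangle (xs ! 0))"
  proof (rule computes_Prec)
    show "computes Zero 0 (\<lambda>_. 0)"
      by (simp add: computes_def rec_eval.zero)
    show "computes (Comp add [Proj 1, Comp Succ [Proj 0]]) (Suc (Suc 0)) (\<lambda>xs. xs ! 1 + Suc (xs ! 0))"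
      using computes_Comp2[OF add computes_Proj[of 1 2] computes_Comp1[OF computes_Succ computes_Proj[of 0 2]]]
      by (simp add: numeral_2_eq_2)
  qed auto
  then show ?thesis by auto
qed

text \<open>The Cantor pairing of \<open>m\<close> and \<open>n\<close> is
  \<open>triangle (m + n) + m\<close>.\<close>

lemma computes_prod_encode: "\<exists>p. computes p 2 (\<lambda>xs. prod_encode (xs ! 0, xs ! 1))"
proof -
  obtain add where add: "computes add 2 (\<lambda>xs. xs ! 0 + xs ! 1)" using computes_plus ..
  obtain tri where tri: "computes tri 1 (\<lambda>xs. triangle (xs ! 0))" using computes_triangle ..
  from computes_Comp2[OF add computes_Comp1[OF tri add] computes_Proj[of 0 2]]
  show ?thesis by (auto simp: prod_encode_def)
qed

lemma computable_iff_computes: "computable f \<longleftrightarrow> (\<exists>p. computes p 1 (\<lambda>xs. f (xs ! 0)))"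
proof -
  have "(\<forall>xs. length xs = 1 \<longrightarrow> rec_eval p xs (f (xs ! 0))) \<longleftrightarrow> (\<forall>x. rec_eval p [x] (f x))" for p
    by (force simp: length_Suc_conv)
  then show ?thesis by (simp add: computable_def computes_def)
qed

lemma computable_const: "computable (\<lambda>_. c)"
  unfolding computable_iff_computes by (rule computes_const)

lemma computable_prod_encode:
  assumes "computable f" "computable g"
  shows "computable (\<lambda>x. prod_encode (f x, g x))"
proof -
  obtain pe where pe: "computes pe 2 (\<lambda>xs. prod_encode (xs ! 0, xs ! 1))"
    using computes_prod_encode ..
  obtain p q where "computes p 1 (\<lambda>xs. f (xs ! 0))" "computes q 1 (\<lambda>xs. g (xs ! 0))"
    using assms unfolding computable_iff_computes by blast
  from computes_Comp2[OF pe this] show ?thesis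
    unfolding computable_iff_computes by auto
qed

lemma computable_id: "computable (\<lambda>x. x)"
  unfolding computable_iff_computes using computes_Proj[of 0 1] by auto

text \<open>Primitive recursion on the number of iterations. The formula for input \<open>x\<close>
  contains an \<open>x\<close>-fold iterate, whose code is obtained in this way.\<close>

lemma computable_iterate:
  assumes "computable h"
  shows "computable (\<lambda>n. (h ^^ n) a)"
proof -
  obtain c where c: "computes c 0 (\<lambda>_. a)" using computes_const ..
  obtain p where p: "computes p 1 (\<lambda>xs. h (xs ! 0))"
    using assms unfolding computable_iff_computes ..
  have "computes (Prec c (Comp p [Proj 1])) (Suc 0) (\<lambda>xs. (h ^^ (xs ! 0)) a)"
    by (rule computes_Prec[OF c computes_Comp1[OF p computes_Proj]]) auto
  then show ?thesis unfolding computable_iff_computes by auto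
qed

subsection \<open>Coding relations by betweenness\<close>

text \<open>
  Elements of the coded structure are the points of \<open>X 0\<close>. As betweenness is symmetric in its
  end points, each of them gets a twin in \<open>X 1\<close>, attached to it by a marker in \<open>X 2\<close>;
  relations are marked between a point and the twin of another one.
\<close>

definition linked :: "'a::metric_space set \<Rightarrow> (nat \<Rightarrow> 'a set) \<Rightarrow> colour \<Rightarrow> 'a \<Rightarrow> 'a \<Rightarrow> bool" where
  "linked T X c u v \<longleftrightarrow> (\<exists>q\<in>T. q \<in> X 1 \<and> (\<exists>m\<in>T. m \<in> X 2 \<and> btw v m q) \<and>
     (\<exists>m\<in>T. m \<in> X (to_nat c + 3) \<and> btw u m q))"

text \<open>The bound variables exceed both \<open>x\<close> and \<open>y\<close>, which prevents
  capture.\<close>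

definition rel_fm :: "colour \<Rightarrow> nat \<Rightarrow> nat \<Rightarrow> fm" where
  "rel_fm c x y =
    (let q = Suc (x + y); m = Suc q in
     Ex q (Conj (Mem 1 q) (Conj
       (Ex m (Conj (Mem 2 m) (Btw y m q)))
       (Ex m (Conj (Mem (to_nat c + 3) m) (Btw x m q))))))"

definition exd :: "nat \<Rightarrow> fm \<Rightarrow> fm" where
  "exd x p = Ex x (Conj (Mem 0 x) p)"

primrec alls :: "nat \<Rightarrow> fm \<Rightarrow> fm" where
  "alls 0 p = p"
| "alls (Suc n) p = alls n (Neg (exd n (Neg p)))"

definition atoms_fm :: "atom list \<Rightarrow> fm \<Rightarrow> fm" where
  "atoms_fm as p = foldr (\<lambda>(c, x, y). Conj (rel_fm c x y)) as p"

text \<open>\<open>Mem 0 n\<close>, true under the relativised quantifier over \<open>n\<close>,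
  ends the conjunction of the head atoms.\<close>

definition rule_fm :: "rule \<Rightarrow> fm" where
  "rule_fm = (\<lambda>(n, body, head).
     alls n (Neg (atoms_fm body (Neg (exd n (atoms_fm head (Mem 0 n)))))))"

lemma sat_rel_fm [simp]: "sat T X e (rel_fm c x y) \<longleftrightarrow> linked T X c (e x) (e y)"
  by (simp add: rel_fm_def linked_def Let_def)

lemma free_vars_rel_fm [simp]: "free_vars (rel_fm c x y) = {x, y}"
  by (auto simp: rel_fm_def Let_def)

lemma sat_exd [simp]: "sat T X e (exd x p) \<longleftrightarrow> (\<exists>a\<in>T \<inter> X 0. sat T X (e(x := a)) p)"
  by (auto simp: exd_def)

lemma free_vars_exd [simp]: "free_vars (exd x p) = free_vars p - {x}"
  by (auto simp: exd_def)

lemma sat_alls: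
  "sat T X e (alls n p) \<longleftrightarrow>
    (\<forall>e'. (\<forall>i<n. e' i \<in> T \<inter> X 0) \<longrightarrow> (\<forall>i\<ge>n. e' i = e i) \<longrightarrow> sat T X e' p)"
proof (induction n arbitrary: p)
  case 0
  have "(\<forall>i. e' i = e i) \<longleftrightarrow> e' = e" for e' by auto
  then show ?case by simp
next
  case (Suc n)
  have "(\<forall>e'. (\<forall>i<n. e' i \<in> T \<inter> X 0) \<longrightarrow> (\<forall>i\<ge>n. e' i = e i) \<longrightarrow>
          (\<forall>a\<in>T \<inter> X 0. sat T X (e'(n := a)) p)) \<longleftrightarrow>
        (\<forall>e'. (\<forall>i<Suc n. e' i \<in> T \<inter> X 0) \<longrightarrow> (\<forall>i\<ge>Suc n. e' i = e i) \<longrightarrow> sat T X e' p)"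
    (is "?L \<longleftrightarrow> ?R")
  proof
    assume L: ?L
    show ?R
    proof (intro allI impI)
      fix e' assume e': "\<forall>i<Suc n. e' i \<in> T \<inter> X 0" "\<forall>i\<ge>Suc n. e' i = e i"
      \<comment> \<open>The hypothesis concerns assignments agreeing with \<open>e\<close> from
        \<open>n\<close> on, so the value at \<open>n\<close> is reset and then restored by the
        inner quantifier.\<close>
      have "sat T X ((e'(n := e n))(n := e' n)) p"
        using L[rule_format, of "e'(n := e n)" "e' n"] e' by (simp add: less_Suc_eq)
      then show "sat T X e' p" by simp
    qed
  next
    assume R: ?R
    show ?L
    proof (intro allI impI ballI)
      fix e' a assume "\<forall>i<n. e' i \<in> T \<inter> X 0" "\<forall>i\<ge>n. e' i = e i" "a \<in> T \<inter> X 0"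
      then show "sat T X (e'(n := a)) p"
        by (intro R[rule_format]) (auto simp: less_Suc_eq)
    qed
  qed
  with Suc show ?case by simp
qed

lemma free_vars_alls [simp]: "free_vars (alls n p) = free_vars p - {..<n}"
  by (induction n arbitrary: p) auto

lemma sat_atoms_fm [simp]:
  "sat T X e (atoms_fm as p) \<longleftrightarrow> atoms_hold (linked T X) e as \<and> sat T X e p"
  by (induction as) (auto simp: atoms_fm_def)

lemma free_vars_atoms_fm [simp]:
  "free_vars (atoms_fm as p) = (\<Union>(c, x, y)\<in>set as. {x, y}) \<union> free_vars p"
  by (induction as) (auto simp: atoms_fm_def)

lemma free_vars_rule_fm: "rule_wf \<rho> \<Longrightarrow> free_vars (rule_fm \<rho>) = {}"
  by (force simp: rule_fm_def rule_wf_def split: prod.splits)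

lemma sat_rule_fm:
  assumes "rule_wf \<rho>"
  shows "sat T X e (rule_fm \<rho>) \<longleftrightarrow> rule_holds (T \<inter> X 0) (linked T X) \<rho>"
proof -
  obtain n body head where \<rho>: "\<rho> = (n, body, head)" by (cases \<rho>)
  have cong: "atoms_hold h f body \<longleftrightarrow> atoms_hold h f' body"
      "atoms_hold h (f(n := a)) head \<longleftrightarrow> atoms_hold h (f'(n := a)) head"
    if "\<forall>i<n. f i = f' i" for h f f' a
    using assms that by (intro atoms_hold_cong; force simp: \<rho> rule_wf_def)+
  have "sat T X e (rule_fm \<rho>) \<longleftrightarrow>
      (\<forall>e'. (\<forall>i<n. e' i \<in> T \<inter> X 0) \<longrightarrow> (\<forall>i\<ge>n. e' i = e i) \<longrightarrow>
        atoms_hold (linked T X) e' body \<longrightarrow>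
        (\<exists>a\<in>T \<inter> X 0. atoms_hold (linked T X) (e'(n := a)) head))"
    by (auto simp: \<rho> rule_fm_def sat_alls)
  also have "\<dots> \<longleftrightarrow> rule_holds (T \<inter> X 0) (linked T X) \<rho>"
    unfolding rule_holds_def \<rho> prod.case
  proof (intro iffI allI impI)
    fix e'
    assume L: "\<forall>e'. (\<forall>i<n. e' i \<in> T \<inter> X 0) \<longrightarrow> (\<forall>i\<ge>n. e' i = e i) \<longrightarrow>
        atoms_hold (linked T X) e' body \<longrightarrow>
        (\<exists>a\<in>T \<inter> X 0. atoms_hold (linked T X) (e'(n := a)) head)"
      and e': "\<forall>i<n. e' i \<in> T \<inter> X 0" "atoms_hold (linked T X) e' body"
    \<comment> \<open>Beyond \<open>n\<close> the assignment is made to agree with \<open>e\<close>;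
      body and head do not see the change.\<close>
    define e'' where "e'' i = (if i < n then e' i else e i)" for i
    have eq: "\<forall>i<n. e'' i = e' i" by (simp add: e''_def)
    have "\<exists>a\<in>T \<inter> X 0. atoms_hold (linked T X) (e''(n := a)) head"
    proof (rule L[rule_format])
      show "atoms_hold (linked T X) e'' body"
        using e'(2) cong(1)[OF eq] by blast
    qed (use e'(1) in \<open>simp_all add: e''_def\<close>)
    then show "\<exists>a\<in>T \<inter> X 0. atoms_hold (linked T X) (e'(n := a)) head"
      using cong(2)[OF eq] by blast
  qed blast
  finally show ?thesis .
qed

section \<open>The halting sentence\<close>

text \<open>Moves variable 0 to some successor of its value. Reusing the variables 0 and 1 lets the
  numeral \<open>x\<close> be expressed by plain iteration, uniformly in \<open>x\<close>.\<close>

definition step_fm :: "fm \<Rightarrow> fm" where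
  "step_fm p = exd 1 (Conj (rel_fm CSuc 0 1) (exd 0 (Conj (Eq 0 1) p)))"

text \<open>No chain of \<open>x\<close> successor steps starting at any zero ends in an accepted
  element.\<close>

definition reject_fm :: "recf \<Rightarrow> nat \<Rightarrow> fm" where
  "reject_fm p x = Neg (exd 0 (Conj (rel_fm CZero 0 0) ((step_fm ^^ x) (rel_fm (CAcc p) 0 0))))"

definition halting_fm :: "recf \<Rightarrow> nat \<Rightarrow> fm" where
  "halting_fm p x = Neg (foldr (\<lambda>\<rho>. Conj (rule_fm \<rho>)) (all_rules p) (reject_fm p x))"

lemma sat_step_fm:
  "sat T X e (step_fm p) \<longleftrightarrow>
    (\<exists>a\<in>T \<inter> X 0. linked T X CSuc (e 0) a \<and> sat T X (e(1 := a, 0 := a)) p)"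
  by (auto simp: step_fm_def)

lemma sat_halting_fm:
  "sat T X e (halting_fm p x) \<longleftrightarrow>
    \<not> ((\<forall>\<rho>\<in>set (all_rules p). rule_holds (T \<inter> X 0) (linked T X) \<rho>) \<and> sat T X e (reject_fm p x))"
proof -
  have "sat T X e (foldr (\<lambda>\<rho>. Conj (rule_fm \<rho>)) rs q) \<longleftrightarrow>
      (\<forall>\<rho>\<in>set rs. rule_holds (T \<inter> X 0) (linked T X) \<rho>) \<and> sat T X e q"
    if "\<forall>\<rho>\<in>set rs. rule_wf \<rho>" for rs q
    using that by (induction rs) (auto simp: sat_rule_fm)
  then show ?thesis
    by (simp add: halting_fm_def rule_wf_all)
qed

lemma free_vars_halting_fm: "free_vars (halting_fm p x) = {}"
proof -
  have "free_vars (foldr (\<lambda>\<rho>. Conj (rule_fm \<rho>)) rs q) = free_vars q"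
    if "\<forall>\<rho>\<in>set rs. rule_wf \<rho>" for rs q
    using that by (induction rs) (auto simp: free_vars_rule_fm)
  moreover have "free_vars ((step_fm ^^ x) (rel_fm (CAcc p) 0 0)) \<subseteq> {0}"
    by (induction x) (auto simp: step_fm_def)
  ultimately show ?thesis
    by (auto simp: halting_fm_def reject_fm_def rule_wf_all)
qed

lemma finite_set_vars: "finite (set_vars p)"
  by (induction p) auto

text \<open>Iterating \<open>step_fm\<close> introduces no set variables beyond those of its first
  application, and the rules do not depend on \<open>x\<close>; so one finite set bounds all these
  formulas.\<close>

lemma set_vars_halting_fm: "\<exists>K. \<forall>x. set_vars (halting_fm p x) \<subseteq> {..<K}"
proof -
  have steps: "set_vars ((step_fm ^^ x) q) \<subseteq> set_vars (step_fm q) \<union> set_vars q" for x q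
    by (induction x) (auto simp: step_fm_def exd_def)
  have rules: "set_vars (foldr (\<lambda>\<rho>. Conj (rule_fm \<rho>)) rs q) \<subseteq>
      set_vars (foldr (\<lambda>\<rho>. Conj (rule_fm \<rho>)) rs (Eq 0 0)) \<union> set_vars q" for rs q
    by (induction rs) auto
  have "set_vars (reject_fm p x) \<subseteq> {0} \<union> set_vars (rel_fm CZero 0 0) \<union>
      set_vars (step_fm (rel_fm (CAcc p) 0 0)) \<union> set_vars (rel_fm (CAcc p) 0 0)" for x
    using steps[of x "rel_fm (CAcc p) 0 0"] by (auto simp: reject_fm_def exd_def)
  then have "set_vars (halting_fm p x) \<subseteq>
      set_vars (foldr (\<lambda>\<rho>. Conj (rule_fm \<rho>)) (all_rules p) (Eq 0 0)) \<union> ({0} \<union>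
      set_vars (rel_fm CZero 0 0) \<union> set_vars (step_fm (rel_fm (CAcc p) 0 0)) \<union>
      set_vars (rel_fm (CAcc p) 0 0))" for x
    unfolding halting_fm_def set_vars.simps
    using rules[of "all_rules p" "reject_fm p x"] by (meson Un_mono subset_refl subset_trans)
  moreover have "finite (set_vars (foldr (\<lambda>\<rho>. Conj (rule_fm \<rho>)) (all_rules p) (Eq 0 0)) \<union> ({0} \<union>
      set_vars (rel_fm CZero 0 0) \<union> set_vars (step_fm (rel_fm (CAcc p) 0 0)) \<union>
      set_vars (rel_fm (CAcc p) 0 0)))"
    by (simp add: finite_set_vars)
  ultimately show ?thesis
    unfolding finite_nat_iff_bounded by (meson subset_trans)
qed

lemma computable_fm_code_Conj:
  "computable (\<lambda>x. fm_code (f x)) \<Longrightarrow> computable (\<lambda>x. fm_code (Conj q (f x)))"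
  by (simp add: computable_prod_encode computable_const)

lemma computable_fm_code_Neg:
  "computable (\<lambda>x. fm_code (f x)) \<Longrightarrow> computable (\<lambda>x. fm_code (Neg (f x)))"
  by (simp add: computable_prod_encode computable_const)

lemma computable_fm_code_exd:
  "computable (\<lambda>x. fm_code (f x)) \<Longrightarrow> computable (\<lambda>x. fm_code (exd v (f x)))"
  by (simp add: exd_def computable_prod_encode computable_const)

text \<open>On codes, \<open>step_fm\<close> acts as a computable function, so its iterates are
  computable in \<open>x\<close>; the rest of the formula is a fixed context.\<close>

lemma computable_halting_fm: "computable (\<lambda>x. fm_code (halting_fm p x))"
proof -
  obtain h where h: "computable h" "\<And>q. fm_code (step_fm q) = h (fm_code q)"
  proof
    show "computable (\<lambda>z. prod_encode (5, prod_encode (1, prod_encode (4, prod_encode (fm_code (Mem 0 1),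
      prod_encode (4, prod_encode (fm_code (rel_fm CSuc 0 1),
      prod_encode (5, prod_encode (0, prod_encode (4, prod_encode (fm_code (Mem 0 0),
      prod_encode (4, prod_encode (fm_code (Eq 0 1), z)))))))))))))"
      by (intro computable_prod_encode computable_const computable_id)
  qed (simp add: step_fm_def exd_def)
  have "fm_code ((step_fm ^^ x) q) = (h ^^ x) (fm_code q)" for x q
    by (induction x) (simp_all add: h)
  then have "computable (\<lambda>x. fm_code ((step_fm ^^ x) (rel_fm (CAcc p) 0 0)))"
    using computable_iterate[OF h(1)] by simp
  then have "computable (\<lambda>x. fm_code (reject_fm p x))"
    unfolding reject_fm_def
    by (intro computable_fm_code_Neg computable_fm_code_exd computable_fm_code_Conj)
  moreover have "computable (\<lambda>x. fm_code (foldr (\<lambda>\<rho>. Conj (rule_fm \<rho>)) rs (f x)))"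
    if "computable (\<lambda>x. fm_code (f x))" for f rs
    using that by (induction rs) (simp_all only: foldr.simps id_apply o_apply computable_fm_code_Conj)
  ultimately show ?thesis
    unfolding halting_fm_def by (intro computable_fm_code_Neg)
qed

section \<open>Correctness of the reduction\<close>

text \<open>If the coded structure satisfies the rules, its chain \<open>num 0\<close>, ...,
  \<open>num x\<close> leads to an accepted element and contradicts rejection.\<close>

lemma halting_fm_sat:
  assumes "rec_eval p [x, y] 1"
  shows "sat T X e (halting_fm p x)"
proof -
  have "\<not> sat T X e (reject_fm p x)"
    if rules: "\<And>\<rho>. \<rho> \<in> set (all_rules p) \<Longrightarrow> rule_holds (T \<inter> X 0) (linked T X) \<rho>"
  proof -
    interpret rule_model "T \<inter> X 0" "linked T X"
      by unfold_locales (simp add: rules all_rules_def)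
    have acc: "linked T X (CAcc p) (num x) (num x)"
      using acc_complete[OF rules assms] .
    \<comment> \<open>With \<open>k\<close> steps left the chain stands at
      \<open>num (x - k)\<close>.\<close>
    have "sat T X e ((step_fm ^^ k) (rel_fm (CAcc p) 0 0))" if "e 0 = num (x - k)" "k \<le> x" for e k
      using that
    proof (induction k arbitrary: e)
      case 0
      then show ?case using acc by simp
    next
      case (Suc k)
      then have "Suc (x - Suc k) = x - k" by simp
      then have "linked T X CSuc (e 0) (num (x - k))"
        using model_simps(2)[of "x - Suc k"] Suc.prems by simp
      then show ?case
        using Suc num_in[of "x - k"] by (auto simp: sat_step_fm simp del: num_in)
    qed
    from this[of "e(0 := num 0)" x]
    have "sat T X (e(0 := num 0)) ((step_fm ^^ x) (rel_fm (CAcc p) 0 0))" by simp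
    then show ?thesis
      unfolding reject_fm_def using num_0
      by (simp del: fun_upd_apply) (auto intro!: bexI[of _ "num 0"])
  qed
  then show ?thesis by (auto simp: sat_halting_fm)
qed

text \<open>The points code the standard model: \<open>P i\<close> is the number \<open>i\<close>,
  \<open>Q i\<close> its twin attached by \<open>M i i\<close>, and \<open>M i j\<close> marks a
  pair in a relation. The privacy of the markers ensures that exactly the intended pairs are
  linked.\<close>

lemma halting_fm_refutable:
  fixes P Q :: "nat \<Rightarrow> 'a::metric_space"
  assumes T: "\<And>i. P i \<in> T" "\<And>i. Q i \<in> T" "\<And>i j. M i j \<in> T"
    and btw: "\<And>i j k l. btw (P k) (M i j) (Q l) \<longleftrightarrow> k = i \<and> l = j"
    and no: "\<And>y. \<not> rec_eval p [x, y] 1"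
  obtains X where "\<And>i. X i \<subseteq> T" "\<And>e. \<not> sat T X e (halting_fm p x)"
proof
  \<comment> \<open>Indices 0 to 2 are taken by elements, twins and attachments, hence the shift by
    3 for colours.\<close>
  define X where "X n = (if n = 0 then range P else if n = 1 then range Q
    else if n = 2 then range (\<lambda>i. M i i) else {M i j | i j. std (from_nat (n - 3)) i j})" for n
  show "X i \<subseteq> T" for i
    using T by (auto simp: X_def)
  have X: "X 0 = range P" "X 1 = range Q" "X 2 = range (\<lambda>i. M i i)"
    "X (to_nat c + 3) = {M i j | i j. std c i j}" for c
    by (simp_all add: X_def)
  have linked: "linked T X c (P i) (P j) \<longleftrightarrow> std c i j" for c i j
  proof
    assume "linked T X c (P i) (P j)"
    then show "std c i j"
      unfolding linked_def X using btw by auto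
  next
    assume "std c i j"
    moreover have "btw (P j) (M j j) (Q j)" "btw (P i) (M i j) (Q j)"
      using btw by simp_all
    ultimately show "linked T X c (P i) (P j)"
      unfolding linked_def X using T by blast
  qed
  have D: "T \<inter> X 0 = range P"
    using T X(1) by auto
  have rules: "\<forall>\<rho>\<in>set (all_rules p). rule_holds (T \<inter> X 0) (linked T X) \<rho>"
    unfolding D by (intro ballI rule_holds_transport[where r = std] linked rule_wf_all std_all)
  \<comment> \<open>In the standard model the only successor of \<open>P i\<close> is
    \<open>P (Suc i)\<close>, so \<open>k\<close> steps lead from \<open>i\<close> to
    \<open>i + k\<close> and nowhere else.\<close>
  have reach: "\<exists>y. rec_eval p [i + k, y] 1"
    if "sat T X e ((step_fm ^^ k) (rel_fm (CAcc p) 0 0))" "e 0 = P i" for e i k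
    using that
  proof (induction k arbitrary: e i)
    case 0
    then show ?case by (simp add: linked)
  next
    case (Suc k)
    then obtain a where a: "a \<in> range P" "linked T X CSuc (P i) a"
      "sat T X (e(1 := a, 0 := a)) ((step_fm ^^ k) (rel_fm (CAcc p) 0 0))"
      by (auto simp: sat_step_fm D)
    then have "a = P (Suc i)" by (auto simp: linked)
    then have "\<exists>y. rec_eval p [Suc i + k, y] 1"
      by (intro Suc.IH[OF a(3)]) simp
    then show ?case by simp
  qed
  show "\<not> sat T X e (halting_fm p x)" for e
  proof
    assume "sat T X e (halting_fm p x)"
    then have "\<not> sat T X e (reject_fm p x)"
      using rules by (simp add: sat_halting_fm)
    then obtain i where "linked T X CZero (P i) (P i)"
      "sat T X (e(0 := P i)) ((step_fm ^^ x) (rel_fm (CAcc p) 0 0))"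
      by (auto simp: reject_fm_def D)
    then show False
      using reach[where e = "e(0 := P i)" and k = x and i = i] no by (simp add: linked)
  qed
qed

theorem theorem6:
  fixes T :: "(real ^ 'n) set"
  assumes "extends_linearly 2 T"
  shows "Sigma01_hard (sentence_code ` monadic_Pi11_theory T)"
  unfolding Sigma01_hard_def
proof (intro allI impI)
  fix A
  assume "Sigma01 A"
  then obtain R p where p: "\<And>x y. rec_eval p [x, y] (of_bool (R x y))"
    and A: "A = {x. \<exists>y. R x y}"
    unfolding Sigma01_def decidable2_def by blast
  \<comment> \<open>When \<open>R x y\<close> fails the value is \<open>0\<close>, and determinism
    excludes the value \<open>1\<close>.\<close>
  have "rec_eval p [x, y] 1 \<longleftrightarrow> R x y" for x y
    using p[of x y] rec_eval_deterministic[OF p[of x y], of 1] by (cases "R x y") auto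
  then have A': "x \<in> A \<longleftrightarrow> (\<exists>y. rec_eval p [x, y] 1)" for x
    by (simp add: A)
  \<comment> \<open>One prefix length serves all inputs and enters the reduction as a
    constant.\<close>
  obtain K where K: "\<And>x. set_vars (halting_fm p x) \<subseteq> {..<K}"
    using set_vars_halting_fm by blast
  obtain P Q :: "nat \<Rightarrow> real ^ 'n" and M :: "nat \<Rightarrow> nat \<Rightarrow> real ^ 'n"
    where PQM: "\<And>i. P i \<in> T" "\<And>i. Q i \<in> T" "\<And>i j. M i j \<in> T"
      "\<And>i j k l. btw (P k) (M i j) (Q l) \<longleftrightarrow> k = i \<and> l = j"
    using regular_flat_configuration[OF assms] by blast
  have "x \<in> A \<longleftrightarrow> holds_in T (K, halting_fm p x)" for x
  proof
    assume "x \<in> A"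
    then show "holds_in T (K, halting_fm p x)"
      using halting_fm_sat unfolding A' holds_in_def by fast
  next
    assume holds: "holds_in T (K, halting_fm p x)"
    show "x \<in> A"
    proof (rule ccontr)
      assume "x \<notin> A"
      then have "\<not> rec_eval p [x, y] 1" for y
        by (simp add: A')
      then obtain X where "\<And>i. X i \<subseteq> T" "\<And>e. \<not> sat T X e (halting_fm p x)"
        using halting_fm_refutable[OF PQM] by blast
      with holds show False
        unfolding holds_in_def by auto
    qed
  qed
  then have "x \<in> A \<longleftrightarrow> sentence_code (K, halting_fm p x) \<in> sentence_code ` monadic_Pi11_theory T" for x
    using K[of x] free_vars_halting_fm[of p x]
    by (simp add: inj_image_mem_iff[OF inj_sentence_code] monadic_Pi11_theory_def
        monadic_Pi11_sentence_def)
  moreover have "computable (\<lambda>x. sentence_code (K, halting_fm p x))"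
    unfolding sentence_code_def prod.case
    by (intro computable_prod_encode computable_const computable_halting_fm)
  ultimately show "many_one_reducible A (sentence_code ` monadic_Pi11_theory T)"
    unfolding many_one_reducible_def by blast
qed

end
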